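(* (i) Let $\Omega$ be an infinite set, $\kappa$ a regular infinite cardinal with $\kappa\le|\Omega|$, and $T\subseteq\mathrm{Self}(\Omega)$. If $|(\alpha)T|<\kappa$ for all $\alpha\in\Omega$, then $\langle T\rangle\prec_{|\Omega|^+}\mathrm{Self}(\Omega)$. (ii) Let $T\subseteq\mathrm{Self}(\omega)$. If there is a finite $\lambda$ with $|(\alpha)T|\le\lambda$ for all $\alpha\in\omega$, then $\langle T\rangle\prec_{\aleph_0}E_\le$.
   Context: $\mathrm{Self}(\Omega)$ is the monoid of maps $\Omega\to\Omega$, written on the right of arguments; $(\alpha)T=\{(\alpha)f:f\in T\}$; $\langle X\rangle$ is the submonoid generated by $X$; $\omega$ is the set of natural numbers. For an infinite cardinal $\kappa$, a monoid $N$ and submonoids $M_1,M_2\subseteq N$, $M_1\preccurlyeq_{\kappa} M_2$ means there is $U\subseteq N$ with $|U|<\kappa$ and $M_1\subseteq\langle M_2\cup U\rangle$; $M_1\prec_\kappa M_2$ means $M_1\preccurlyeq_\kappa M_2$ and not $M_2\preccurlyeq_\kappa M_1$ (here $N=\mathrm{Self}(\Omega)$, resp. $\mathrm{Self}(\omega)$). $|\Omega|^+$ is the successor cardinal of $|\Omega|$. $E_\le\subseteq\mathrm{Self}(\omega)$ is the submonoid of maps $f$ with $(\alpha)f\le\alpha$ for all $\alpha\in\omega$. *)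

theory Defs
  imports "HOL-Algebra.Group" "HOL.Hull"
begin

unbundle cardinal_syntax

text \<open>Maps on \<open>\<Omega>\<close> are represented extensionally, as in the library's \<open>BijGroup\<close>.
  They act on the right, so the product of \<open>f\<close> and \<open>g\<close> applies \<open>f\<close> first.\<close>

definition Self :: "'a set \<Rightarrow> ('a \<Rightarrow> 'a) monoid" where
  "Self \<Omega> = \<lparr>carrier = \<Omega> \<rightarrow>\<^sub>E \<Omega>, mult = (\<lambda>f g. compose \<Omega> g f), one = (\<lambda>\<alpha>\<in>\<Omega>. \<alpha>)\<rparr>"

definition images :: "'a \<Rightarrow> ('a \<Rightarrow> 'a) set \<Rightarrow> 'a set" where
  "images \<alpha> T = (\<lambda>f. f \<alpha>) ` T"

definition submonoid_generated :: "('m, 'b) monoid_scheme \<Rightarrow> 'm set \<Rightarrow> 'm set" where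
  "submonoid_generated N X = (\<lambda>H. submonoid H N) hull X"

text \<open>Meant for an infinite cardinal \<open>\<kappa>\<close>, a monoid \<open>N\<close> and submonoids \<open>M\<^sub>1\<close>, \<open>M\<^sub>2\<close> of \<open>N\<close>.\<close>

definition preceq_card :: "'k rel \<Rightarrow> ('m, 'b) monoid_scheme \<Rightarrow> 'm set \<Rightarrow> 'm set \<Rightarrow> bool" where
  "preceq_card \<kappa> N M\<^sub>1 M\<^sub>2 \<longleftrightarrow>
     (\<exists>U \<subseteq> carrier N. |U| <o \<kappa> \<and> M\<^sub>1 \<subseteq> submonoid_generated N (M\<^sub>2 \<union> U))"

definition prec_card :: "'k rel \<Rightarrow> ('m, 'b) monoid_scheme \<Rightarrow> 'm set \<Rightarrow> 'm set \<Rightarrow> bool" where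
  "prec_card \<kappa> N M\<^sub>1 M\<^sub>2 \<longleftrightarrow> preceq_card \<kappa> N M\<^sub>1 M\<^sub>2 \<and> \<not> preceq_card \<kappa> N M\<^sub>2 M\<^sub>1"

definition E_le :: "(nat \<Rightarrow> nat) set" where
  "E_le = {f \<in> carrier (Self UNIV). \<forall>\<alpha>. f \<alpha> \<le> \<alpha>}"

lemma monoid_Self: "monoid (Self \<Omega>)"
proof (rule monoidI)
  fix f g h assume "f \<in> carrier (Self \<Omega>)" "g \<in> carrier (Self \<Omega>)" "h \<in> carrier (Self \<Omega>)"
  then show "f \<otimes>\<^bsub>Self \<Omega>\<^esub> g \<otimes>\<^bsub>Self \<Omega>\<^esub> h = f \<otimes>\<^bsub>Self \<Omega>\<^esub> (g \<otimes>\<^bsub>Self \<Omega>\<^esub> h)"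
    by (auto simp: Self_def compose_assoc PiE_def)
qed (auto simp: Self_def PiE_def Id_compose compose_Id compose_eq)

lemma submonoid_submonoid_generated:
  assumes "monoid N" "X \<subseteq> carrier N"
  shows "submonoid (submonoid_generated N X) N"
proof -
  interpret monoid N by fact
  have c: "submonoid (carrier N) N"
    by (rule submonoid.intro) auto
  show ?thesis
  proof (rule submonoid.intro)
    show "submonoid_generated N X \<subseteq> carrier N"
      unfolding submonoid_generated_def by (rule hull_minimal[where S="\<lambda>H. submonoid H N", OF assms(2) c])
  qed (auto simp: submonoid_generated_def hull_def intro: submonoid.m_closed submonoid.one_closed)
qed

lemma submonoid_E_le: "submonoid E_le (Self UNIV)"
proof (rule submonoid.intro)
  fix f g assume "f \<in> E_le" "g \<in> E_le"
  then show "f \<otimes>\<^bsub>Self UNIV\<^esub> g \<in> E_le"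
    by (auto simp: E_le_def Self_def compose_def intro: le_trans)
qed (auto simp: E_le_def Self_def)

end

theory Submission
  imports Defs "HOL-Algebra.Free_Abelian_Groups"
begin

text \<open>
  Write an element of \<open>\<langle>T \<union> U\<rangle>\<close> as a word over \<open>U \<union> {*}\<close>, where \<open>*\<close> stands for an
  unspecified factor from \<open>T\<close>. There are at most \<open>|\<Omega>|\<close> words, and all maps with a given word
  send a point \<open>\<alpha>\<close> into one set, which is smaller than \<open>\<kappa>\<close> by regularity (in the second part, of
  size at most \<open>\<lambda>\<^sup>n\<close> for a word of length \<open>n\<close>). Attaching distinct points to distinct words, a map
  that leaves the set of each word at the attached point lies outside \<open>\<langle>T \<union> U\<rangle>\<close>; in the
  second part the point is chosen so large that there is room for this below the point.
  Conversely, if \<open>|(\<alpha>)T| \<le> \<lambda>\<close>, list \<open>(\<alpha>)T\<close> as \<open>x\<^sub>0, x\<^sub>1, \<dots>\<close>. Then \<open>f \<in> T\<close> factors as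
  \<open>\<alpha> \<mapsto> \<lambda>\<alpha> + \<lambda> - 1 \<mapsto> \<lambda>\<alpha> + i \<mapsto> x\<^sub>i = (\<alpha>)f\<close>, where the outer maps do not depend on \<open>f\<close>
  and the middle one is in \<open>E\<^sub>\<le>\<close>.
\<close>

section \<open>Words and the points they reach\<close>

text \<open>A word is encoded as a list of sets of maps: \<open>T\<close> itself for the letter \<open>*\<close>, and \<open>{u}\<close> for
  the letter \<open>u \<in> U\<close>.\<close>

fun reach :: "('a \<Rightarrow> 'a) set list \<Rightarrow> 'a \<Rightarrow> 'a set" where
  "reach [] \<alpha> = {\<alpha>}"
| "reach (B # w) \<alpha> = (\<Union>\<beta>\<in>images \<alpha> B. reach w \<beta>)"

lemma reach_append: "reach (v @ w) \<alpha> = (\<Union>\<beta>\<in>reach v \<alpha>. reach w \<beta>)"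
  by (induction v arbitrary: \<alpha>) auto

text \<open>Composition corresponds to concatenation of words and the identity to the empty word, so
  the maps covered by some word form a submonoid. One word serves all points at once; the diagonal
  argument relies on this.\<close>

lemma submonoid_generated_reach:
  assumes B: "\<B> \<subseteq> Pow (carrier (Self \<Omega>))" and f: "f \<in> submonoid_generated (Self \<Omega>) (\<Union>\<B>)"
  shows "\<exists>w\<in>lists \<B>. \<forall>\<alpha>\<in>\<Omega>. f \<alpha> \<in> reach w \<alpha>"
proof -
  let ?H = "{f \<in> carrier (Self \<Omega>). \<exists>w\<in>lists \<B>. \<forall>\<alpha>\<in>\<Omega>. f \<alpha> \<in> reach w \<alpha>}"
  have "submonoid ?H (Self \<Omega>)"
  proof (rule submonoid.intro)
    fix f g assume f: "f \<in> ?H" and g: "g \<in> ?H"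
    obtain v where v: "v \<in> lists \<B>" "\<forall>\<alpha>\<in>\<Omega>. f \<alpha> \<in> reach v \<alpha>" using f by blast
    obtain w where w: "w \<in> lists \<B>" "\<forall>\<alpha>\<in>\<Omega>. g \<alpha> \<in> reach w \<alpha>" using g by blast
    have "v @ w \<in> lists \<B>" using v w by simp
    moreover have "\<forall>\<alpha>\<in>\<Omega>. (f \<otimes>\<^bsub>Self \<Omega>\<^esub> g) \<alpha> \<in> reach (v @ w) \<alpha>"
    proof
      fix \<alpha> assume \<alpha>: "\<alpha> \<in> \<Omega>"
      then have "f \<alpha> \<in> \<Omega>" using f by (auto simp: Self_def)
      then have "g (f \<alpha>) \<in> reach (v @ w) \<alpha>"
        unfolding reach_append using v(2) w(2) \<alpha> by blast
      then show "(f \<otimes>\<^bsub>Self \<Omega>\<^esub> g) \<alpha> \<in> reach (v @ w) \<alpha>"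
        using \<alpha> by (simp add: Self_def compose_eq)
    qed
    moreover have "f \<otimes>\<^bsub>Self \<Omega>\<^esub> g \<in> carrier (Self \<Omega>)"
      using f g monoid.m_closed[OF monoid_Self] by blast
    ultimately show "f \<otimes>\<^bsub>Self \<Omega>\<^esub> g \<in> ?H" by blast
  next
    have "\<forall>\<alpha>\<in>\<Omega>. \<one>\<^bsub>Self \<Omega>\<^esub> \<alpha> \<in> reach [] \<alpha>" by (simp add: Self_def)
    then show "\<one>\<^bsub>Self \<Omega>\<^esub> \<in> ?H"
      using monoid.one_closed[OF monoid_Self] by blast
  qed blast
  moreover have "\<Union>\<B> \<subseteq> ?H"
  proof
    fix f assume "f \<in> \<Union>\<B>"
    then obtain B where "B \<in> \<B>" "f \<in> B" by blast
    then have "[B] \<in> lists \<B>" "\<forall>\<alpha>\<in>\<Omega>. f \<alpha> \<in> reach [B] \<alpha>" by (auto simp: images_def)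
    then show "f \<in> ?H" using \<open>B \<in> \<B>\<close> \<open>f \<in> B\<close> B by blast
  qed
  ultimately have "submonoid_generated (Self \<Omega>) (\<Union>\<B>) \<subseteq> ?H"
    unfolding submonoid_generated_def by (intro hull_minimal)
  then show ?thesis using f by blast
qed

section \<open>Diagonalization against all words\<close>

text \<open>A word for \<open>f\<close> must cover \<open>f\<close> at every point, so one bad value
  at \<open>c w\<close> rules out \<open>w\<close>; injectivity of \<open>c\<close> lets a single
  map rule out all words. \<open>D\<close> prescribes the admissible values: all of \<Omega> in the
  first part, \<open>{..\<alpha>}\<close> in the second, to stay inside \<open>E_le\<close>.\<close>

lemma diagonal_map:
  assumes B: "\<B> \<subseteq> Pow (carrier (Self \<Omega>))"
    and c: "inj_on c (lists \<B>)" "c ` lists \<B> \<subseteq> \<Omega>"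
    and D: "\<And>\<alpha>. \<alpha> \<in> \<Omega> \<Longrightarrow> \<alpha> \<in> D \<alpha> \<and> D \<alpha> \<subseteq> \<Omega>"
    and small: "\<And>w. w \<in> lists \<B> \<Longrightarrow> \<not> D (c w) \<subseteq> reach w (c w)"
  obtains f where "f \<in> carrier (Self \<Omega>)" "\<And>\<alpha>. \<alpha> \<in> \<Omega> \<Longrightarrow> f \<alpha> \<in> D \<alpha>"
    "f \<notin> submonoid_generated (Self \<Omega>) (\<Union>\<B>)"
proof -
  have "\<forall>w\<in>lists \<B>. \<exists>y. y \<in> D (c w) \<and> y \<notin> reach w (c w)"
    using small by blast
  then obtain g where g: "\<And>w. w \<in> lists \<B> \<Longrightarrow> g w \<in> D (c w) \<and> g w \<notin> reach w (c w)"
    unfolding bchoice_iff by blast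
  \<comment> \<open>Points attached to no word are fixed, which is admissible because
    \<open>\<alpha> \<in> D \<alpha>\<close>.\<close>
  define f where
    "f = (\<lambda>\<alpha>\<in>\<Omega>. if \<alpha> \<in> c ` lists \<B> then g (inv_into (lists \<B>) c \<alpha>) else \<alpha>)"
  have fc: "f (c w) = g w" if "w \<in> lists \<B>" for w
  proof -
    have "c w \<in> \<Omega>" "c w \<in> c ` lists \<B>" using that c(2) by blast+
    then show ?thesis by (simp add: f_def inv_into_f_f[OF c(1) that])
  qed
  have fD: "f \<alpha> \<in> D \<alpha>" if "\<alpha> \<in> \<Omega>" for \<alpha>
  proof (cases "\<alpha> \<in> c ` lists \<B>")
    case True
    then obtain w where "w \<in> lists \<B>" "\<alpha> = c w" by blast
    then show ?thesis using fc g by simp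
  next
    case False
    then show ?thesis using that D by (simp add: f_def)
  qed
  have "f \<in> carrier (Self \<Omega>)"
    unfolding Self_def monoid.simps partial_object.simps
  proof (rule PiE_I)
    show "f \<alpha> \<in> \<Omega>" if "\<alpha> \<in> \<Omega>" for \<alpha>
      using fD[OF that] D[OF that] by blast
  qed (simp add: f_def)
  moreover have "f \<notin> submonoid_generated (Self \<Omega>) (\<Union>\<B>)"
  proof
    assume "f \<in> submonoid_generated (Self \<Omega>) (\<Union>\<B>)"
    then obtain w where w: "w \<in> lists \<B>" "\<forall>\<alpha>\<in>\<Omega>. f \<alpha> \<in> reach w \<alpha>"
      using submonoid_generated_reach[OF B] by blast
    then have "f (c w) \<in> reach w (c w)" using c(2) by blast
    then show False using fc g w(1) by simp
  qed
  ultimately show ?thesis using that fD by blast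
qed

section \<open>Counting words and bounding their reach\<close>

abbreviation letters :: "'m set \<Rightarrow> 'm set \<Rightarrow> 'm set set" where
  "letters T U \<equiv> insert T ((\<lambda>u. {u}) ` U)"

text \<open>Adding the letter \<open>T\<close> keeps the alphabet at size at most that of \<Omega>,
  and an infinite set has as many finite lists as elements.\<close>

lemma inj_on_lists_letters:
  fixes \<Omega> :: "'a set"
  assumes "infinite \<Omega>" "|U| \<le>o |\<Omega>|"
  obtains c where "inj_on c (lists (letters T U))" "c ` lists (letters T U) \<subseteq> \<Omega>"
proof -
  have "|(\<lambda>u. {u}) ` U| \<le>o |\<Omega>|"
    using card_of_image assms(2) ordLeq_transitive by blast
  moreover have "|{T}| \<le>o |\<Omega>|"
    using assms(1) by (intro ordLess_imp_ordLeq finite_ordLess_infinite2) auto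
  ultimately have "|{T} \<union> (\<lambda>u. {u}) ` U| \<le>o |\<Omega>|"
    using assms(1) by (intro card_of_Un_ordLeq_infinite)
  then have "|lists (letters T U)| \<le>o |lists \<Omega>|"
    by simp
  then have "|lists (letters T U)| \<le>o |\<Omega>|"
    using card_of_lists_infinite[OF assms(1)] ordLeq_ordIso_trans by blast
  then show ?thesis using that unfolding card_of_ordLeq[symmetric] by blast
qed

text \<open>Each letter contributes a union of fewer than \<kappa> sets of size below \<kappa>,
  which regularity keeps below \<kappa>.\<close>

lemma card_reach_less:
  fixes \<Omega> :: "'a set" and \<kappa> :: "'k rel"
  assumes \<kappa>: "Card_order \<kappa>" "cinfinite \<kappa>" "regularCard \<kappa>"
    and T: "T \<subseteq> carrier (Self \<Omega>)" "\<And>\<alpha>. \<alpha> \<in> \<Omega> \<Longrightarrow> |images \<alpha> T| <o \<kappa>"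
    and U: "U \<subseteq> carrier (Self \<Omega>)"
    and "w \<in> lists (letters T U)" "\<alpha> \<in> \<Omega>"
  shows "|reach w \<alpha>| <o \<kappa>"
proof -
  \<comment> \<open>Infinitude of \<kappa> handles singletons: the reach of the empty word and the
    image of a point under a letter \<open>{u}\<close>.\<close>
  have "natLeq \<le>o \<kappa>" using \<kappa> by (intro natLeq_ordLeq_cinfinite conjI)
  then have fin: "|{x}| <o \<kappa>" for x :: 'a
    using ordLess_ordLeq_trans[OF finite_iff_ordLess_natLeq[THEN iffD1]] by blast
  show ?thesis
    using assms(7,8)
  proof (induction w arbitrary: \<alpha> rule: list.induct)
    case Nil
    then show ?case by (simp add: fin)
  next
    case (Cons B w)
    then have B: "B \<in> letters T U" and w: "w \<in> lists (letters T U)" by auto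
    have "|images \<alpha> B| <o \<kappa>"
      using B Cons.prems T(2) fin by (auto simp: images_def)
    \<comment> \<open>The next points must stay in \<Omega>, since the induction hypothesis is
      applied only to points there.\<close>
    moreover have "B \<subseteq> carrier (Self \<Omega>)" using B T(1) U by auto
    then have "images \<alpha> B \<subseteq> \<Omega>"
      using Cons.prems by (auto simp: images_def Self_def)
    ultimately show ?case
      using Cons.IH[OF w] \<kappa> by (auto intro!: regularCard_UNION_bound)
  qed
qed

text \<open>Each letter multiplies the number of reachable points by at most \<open>l\<close>;
  \<open>1 \<le> l\<close> makes this true of the letters \<open>{u}\<close> as well.\<close>

lemma card_reach_le:
  assumes l: "1 \<le> l" and T: "\<And>\<alpha>. finite (images \<alpha> T) \<and> card (images \<alpha> T) \<le> l"
    and "w \<in> lists (letters T U)"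
  shows "finite (reach w \<alpha>) \<and> card (reach w \<alpha>) \<le> l ^ length w"
  using assms(3)
proof (induction w arbitrary: \<alpha> rule: list.induct)
  case (Cons B w)
  then have B: "B \<in> letters T U" and w: "w \<in> lists (letters T U)" by auto
  have B': "finite (images \<alpha> B)" "card (images \<alpha> B) \<le> l"
    using B T l by (auto simp: images_def)
  have "card (reach (B # w) \<alpha>) \<le> (\<Sum>\<beta>\<in>images \<alpha> B. card (reach w \<beta>))"
    using B'(1) by (simp add: card_UN_le)
  also have "\<dots> \<le> card (images \<alpha> B) * l ^ length w"
    using sum_bounded_above[of "images \<alpha> B" "\<lambda>\<beta>. card (reach w \<beta>)"] Cons.IH[OF w] by simp
  also have "\<dots> \<le> l ^ length (B # w)"
    using B'(2) by simp
  finally show ?case using B' Cons.IH[OF w] by simp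
qed simp

lemma Union_letters: "\<Union>(letters T U) = T \<union> U"
  by auto

section \<open>Comparison with the monoid of all maps\<close>

lemma prec_card_carrier_Self:
  fixes \<Omega> :: "'a set" and \<kappa> :: "'k rel"
  assumes \<Omega>: "infinite \<Omega>"
    and \<kappa>: "Card_order \<kappa>" "cinfinite \<kappa>" "regularCard \<kappa>" "\<kappa> \<le>o |\<Omega>|"
    and T: "T \<subseteq> carrier (Self \<Omega>)" "\<And>\<alpha>. \<alpha> \<in> \<Omega> \<Longrightarrow> |images \<alpha> T| <o \<kappa>"
  shows "prec_card (cardSuc |\<Omega>| ) (Self \<Omega>) (submonoid_generated (Self \<Omega>) T) (carrier (Self \<Omega>))"
  unfolding prec_card_def
proof
  have "|{} :: ('a \<Rightarrow> 'a) set| <o cardSuc |\<Omega>|"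
    by (simp add: cardSuc_ordLeq_ordLess card_of_Card_order card_of_empty)
  moreover have "submonoid_generated (Self \<Omega>) T
      \<subseteq> submonoid_generated (Self \<Omega>) (carrier (Self \<Omega>) \<union> {})"
    unfolding submonoid_generated_def using T(1) by (intro hull_mono) simp
  ultimately show "preceq_card (cardSuc |\<Omega>| ) (Self \<Omega>) (submonoid_generated (Self \<Omega>) T)
      (carrier (Self \<Omega>))"
    unfolding preceq_card_def by blast
  show "\<not> preceq_card (cardSuc |\<Omega>| ) (Self \<Omega>) (carrier (Self \<Omega>)) (submonoid_generated (Self \<Omega>) T)"
  proof
    assume "preceq_card (cardSuc |\<Omega>| ) (Self \<Omega>) (carrier (Self \<Omega>)) (submonoid_generated (Self \<Omega>) T)"
    \<comment> \<open>\<open>hull_Un_left\<close> absorbs the inner hull: the submonoid generated by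
      \<open>T\<close> may be replaced by \<open>T\<close> itself next to \<open>U\<close>.\<close>
    then obtain U where U: "U \<subseteq> carrier (Self \<Omega>)" "|U| <o cardSuc |\<Omega>|"
      and gen: "carrier (Self \<Omega>) \<subseteq> submonoid_generated (Self \<Omega>) (T \<union> U)"
      unfolding preceq_card_def submonoid_generated_def hull_Un_left[symmetric] by blast
    have "|U| \<le>o |\<Omega>|"
      using U(2) by (simp add: cardSuc_ordLeq_ordLess card_of_Card_order)
    then obtain c where c: "inj_on c (lists (letters T U))" "c ` lists (letters T U) \<subseteq> \<Omega>"
      using inj_on_lists_letters[OF \<Omega>] by blast
    have small: "\<not> \<Omega> \<subseteq> reach w (c w)" if "w \<in> lists (letters T U)" for w
    proof
      assume "\<Omega> \<subseteq> reach w (c w)"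
      then have "\<kappa> \<le>o |reach w (c w)|"
        using \<kappa>(4) card_of_mono1 ordLeq_transitive by blast
      moreover have "|reach w (c w)| <o \<kappa>"
        using card_reach_less[OF \<kappa>(1-3) T U(1) that] c(2) that by blast
      ultimately show False using not_ordLess_ordLeq by blast
    qed
    have "letters T U \<subseteq> Pow (carrier (Self \<Omega>))" using T(1) U(1) by auto
    from diagonal_map[OF this c, of "\<lambda>_. \<Omega>"] small
    obtain f where "f \<in> carrier (Self \<Omega>)" "f \<notin> submonoid_generated (Self \<Omega>) (T \<union> U)"
      unfolding Union_letters by blast
    then show False using gen by blast
  qed
qed

section \<open>Comparison with \<open>E_le\<close>\<close>

lemma preceq_card_E_le:
  fixes T :: "(nat \<Rightarrow> nat) set"
  assumes l: "1 \<le> l" and T: "\<And>\<alpha>. finite (images \<alpha> T) \<and> card (images \<alpha> T) \<le> l"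
  shows "preceq_card natLeq (Self UNIV) (submonoid_generated (Self UNIV) T) E_le"
proof -
  \<comment> \<open>An image set with fewer than \<open>l\<close> points is listed with surplus
    values; inclusion suffices.\<close>
  have "\<exists>x. images \<alpha> T \<subseteq> x ` {..<l}" for \<alpha>
  proof -
    obtain h where "bij_betw h {0..<card (images \<alpha> T)} (images \<alpha> T)"
      using ex_bij_betw_nat_finite T by blast
    then have "images \<alpha> T = h ` {0..<card (images \<alpha> T)}" by (simp add: bij_betw_def)
    also have "\<dots> \<subseteq> h ` {..<l}" using T[of \<alpha>] by (intro image_mono) auto
    finally show ?thesis by blast
  qed
  then obtain x where x: "\<And>\<alpha>. images \<alpha> T \<subseteq> x \<alpha> ` {..<l}" by metis
  \<comment> \<open>\<open>u \<alpha>\<close> is the last number of the block with quotient \<alpha>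
    modulo division by \<open>l\<close>, so a decreasing move can reach every place of the block.
    \<open>v\<close> decodes block and place.\<close>
  define u where "u \<alpha> = l * \<alpha> + l - 1" for \<alpha>
  define v where "v n = x (n div l) (n mod l)" for n
  have carrier: "f \<in> carrier (Self UNIV)" for f :: "nat \<Rightarrow> nat" by (simp add: Self_def)
  have sub: "submonoid (submonoid_generated (Self UNIV) (E_le \<union> {u, v})) (Self UNIV)"
    using carrier by (intro submonoid_submonoid_generated monoid_Self) auto
  have gen: "E_le \<union> {u, v} \<subseteq> submonoid_generated (Self UNIV) (E_le \<union> {u, v})"
    unfolding submonoid_generated_def by (rule hull_subset)
  have "T \<subseteq> submonoid_generated (Self UNIV) (E_le \<union> {u, v})"
  proof
    fix f assume "f \<in> T"
    then have "\<exists>i<l. f \<alpha> = x \<alpha> i" for \<alpha> using x[of \<alpha>] by (auto simp: images_def)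
    then obtain i where i: "\<And>\<alpha>. i \<alpha> < l" "\<And>\<alpha>. f \<alpha> = x \<alpha> (i \<alpha>)" by metis
    \<comment> \<open>The cap \<open>min n\<close> puts \<open>g\<close> into \<open>E_le\<close>;
      at \<open>n = u \<alpha>\<close> it is inactive because \<open>i \<alpha> < l\<close>.\<close>
    define g where "g n = min n (l * (n div l) + i (n div l))" for n
    have "g \<in> E_le" using carrier by (simp add: E_le_def g_def)
    moreover have "f = u \<otimes>\<^bsub>Self UNIV\<^esub> g \<otimes>\<^bsub>Self UNIV\<^esub> v"
    proof
      fix \<alpha>
      have "u \<alpha> div l = \<alpha>" using l by (intro div_nat_eqI) (auto simp: u_def)
      moreover have "l * \<alpha> + i \<alpha> \<le> u \<alpha>" using i(1)[of \<alpha>] by (simp add: u_def)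
      ultimately have "g (u \<alpha>) = l * \<alpha> + i \<alpha>" by (simp add: g_def)
      then have "v (g (u \<alpha>)) = f \<alpha>" using i[of \<alpha>] by (simp add: v_def)
      then show "f \<alpha> = (u \<otimes>\<^bsub>Self UNIV\<^esub> g \<otimes>\<^bsub>Self UNIV\<^esub> v) \<alpha>"
        by (simp add: Self_def compose_def)
    qed
    ultimately show "f \<in> submonoid_generated (Self UNIV) (E_le \<union> {u, v})"
      using gen submonoid.m_closed[OF sub] by auto
  qed
  then have "submonoid_generated (Self UNIV) T \<subseteq> submonoid_generated (Self UNIV) (E_le \<union> {u, v})"
    using sub unfolding submonoid_generated_def[of _ T] by (intro hull_minimal)
  moreover have "|{u, v}| <o natLeq" by (simp flip: finite_iff_ordLess_natLeq)
  ultimately show ?thesis using carrier unfolding preceq_card_def by blast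
qed

lemma prec_card_E_le:
  fixes T :: "(nat \<Rightarrow> nat) set"
  assumes l: "1 \<le> l" and T: "\<And>\<alpha>. finite (images \<alpha> T) \<and> card (images \<alpha> T) \<le> l"
  shows "prec_card natLeq (Self UNIV) (submonoid_generated (Self UNIV) T) E_le"
  unfolding prec_card_def
proof
  show "preceq_card natLeq (Self UNIV) (submonoid_generated (Self UNIV) T) E_le"
    by (rule preceq_card_E_le[OF assms])
  show "\<not> preceq_card natLeq (Self UNIV) E_le (submonoid_generated (Self UNIV) T)"
  proof
    assume "preceq_card natLeq (Self UNIV) E_le (submonoid_generated (Self UNIV) T)"
    then obtain U where U: "|U| <o natLeq"
      and gen: "E_le \<subseteq> submonoid_generated (Self UNIV) (T \<union> U)"
      unfolding preceq_card_def submonoid_generated_def hull_Un_left[symmetric] by blast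
    have "|U| \<le>o |UNIV :: nat set|"
      using U finite_iff_ordLess_natLeq[of U]
      by (intro ordLess_imp_ordLeq finite_ordLess_infinite2) simp_all
    then obtain e :: "_ \<Rightarrow> nat" where e: "inj_on e (lists (letters T U))"
      by (rule inj_on_lists_letters[OF infinite_UNIV_nat])
    \<comment> \<open>Pairing yields both requirements: the first component makes \<open>c\<close>
      injective, the second makes \<open>c w\<close> at least \<open>l ^ length w\<close>.\<close>
    define c where "c w = prod_encode (e w, l ^ length w)" for w :: "(nat \<Rightarrow> nat) set list"
    have inj: "inj_on c (lists (letters T U))"
      using e by (auto simp: inj_on_def c_def)
    have small: "\<not> {..c w} \<subseteq> reach w (c w)" if "w \<in> lists (letters T U)" for w
    proof
      assume "{..c w} \<subseteq> reach w (c w)"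
      \<comment> \<open>Strict, since \<open>{..c w}\<close> has \<open>c w + 1\<close>
        elements.\<close>
      then have "c w < card (reach w (c w))"
        using card_reach_le[OF assms that, of "c w"] card_mono[of "reach w (c w)" "{..c w}"]
        by simp
      also have "\<dots> \<le> l ^ length w" using card_reach_le[OF assms that] by blast
      also have "\<dots> \<le> c w" by (simp add: c_def le_prod_encode_2)
      finally show False by simp
    qed
    have "letters T U \<subseteq> Pow (carrier (Self UNIV))" by (auto simp: Self_def)
    then obtain f where "f \<in> carrier (Self UNIV)" "\<And>\<alpha>. \<alpha> \<in> UNIV \<Longrightarrow> f \<alpha> \<in> {..\<alpha>}"
      "f \<notin> submonoid_generated (Self UNIV) (\<Union>(letters T U))"
    proof (rule diagonal_map[OF _ inj, where D = "\<lambda>\<alpha>. {..\<alpha>}"])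
      show "\<not> {..c w} \<subseteq> reach w (c w)" if "w \<in> lists (letters T U)" for w
        by (rule small[OF that])
    qed simp_all
    then show False using gen unfolding Union_letters by (auto simp: E_le_def)
  qed
qed

theorem theorem9:
  shows "(\<forall>(\<Omega> :: 'a set) (\<kappa> :: 'k rel) (T :: ('a \<Rightarrow> 'a) set).
            infinite \<Omega> \<longrightarrow> Card_order \<kappa> \<longrightarrow> cinfinite \<kappa> \<longrightarrow> regularCard \<kappa> \<longrightarrow> \<kappa> \<le>o |\<Omega>| \<longrightarrow>
            T \<subseteq> carrier (Self \<Omega>) \<longrightarrow> (\<forall>\<alpha>\<in>\<Omega>. |images \<alpha> T| <o \<kappa>) \<longrightarrow>
            prec_card (cardSuc |\<Omega>| ) (Self \<Omega>) (submonoid_generated (Self \<Omega>) T) (carrier (Self \<Omega>)))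
       \<and> (\<forall>T :: (nat \<Rightarrow> nat) set.
            T \<subseteq> carrier (Self UNIV) \<longrightarrow>
            (\<exists>l :: nat. \<forall>\<alpha>. finite (images \<alpha> T) \<and> card (images \<alpha> T) \<le> l) \<longrightarrow>
            prec_card natLeq (Self UNIV) (submonoid_generated (Self UNIV) T) E_le)"
proof (intro conjI allI impI)
  fix \<Omega> :: "'a set" and \<kappa> :: "'k rel" and T :: "('a \<Rightarrow> 'a) set"
  assume "infinite \<Omega>" "Card_order \<kappa>" "cinfinite \<kappa>" "regularCard \<kappa>" "\<kappa> \<le>o |\<Omega>|"
    "T \<subseteq> carrier (Self \<Omega>)" "\<forall>\<alpha>\<in>\<Omega>. |images \<alpha> T| <o \<kappa>"
  then show "prec_card (cardSuc |\<Omega>| ) (Self \<Omega>) (submonoid_generated (Self \<Omega>) T) (carrier (Self \<Omega>))"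
    by (intro prec_card_carrier_Self) auto
next
  fix T :: "(nat \<Rightarrow> nat) set"
  assume "\<exists>l :: nat. \<forall>\<alpha>. finite (images \<alpha> T) \<and> card (images \<alpha> T) \<le> l"
  then obtain l where "\<And>\<alpha>. finite (images \<alpha> T) \<and> card (images \<alpha> T) \<le> l" by blast
  then show "prec_card natLeq (Self UNIV) (submonoid_generated (Self UNIV) T) E_le"
    \<comment> \<open>The given bound may be 0, when \<open>T\<close> is empty; \<open>max\<close>
      raises it to at least 1.\<close>
    by (intro prec_card_E_le[of "max l 1"]) (auto simp: le_max_iff_disj)
qed

end
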